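(* Let $\langle F_i:i<\omega\rangle$ be a sequence enumerating the finite subsets of $\omega$ so that each finite subset appears infinitely often, and assume that for each $i<\omega$, $F_i\subseteq\{0,\dots,i-2\}$ and $F_{3i}=F_{3i+2}=\emptyset$. Then there is an infinite strong triangle-free tree $\mathbb{S}$ with coding nodes $\langle c_n:n<\omega\rangle$, dense in $\mathbb{S}$, which satisfies property $(A_3)^{\mathrm{tree}}$ with respect to $\langle F_i:i<\omega\rangle$ and codes $\mathcal{H}_3$; moreover, for each $i<\omega$ and $j\le 2$, the coding node $c_{4i+j}$ meets requirement $F_{3i+j}$.
   Context: Binary sequences, trees: $2^{<\omega}$ is the set of finite binary sequences ordered by extension; $|s|$ is the length of $s$; $0^l$ is the sequence of $l$ zeros. A tree is a subset $T\subseteq 2^{<\omega}$ closed under meets (longest common initial segments) such that $s,t\in T$, $|s|\le|t|$ imply $t\restriction|s|\in T$. The stem of $T$ is the longest node comparable with every node of $T$. A tree with coding nodes consists of a tree $T$, $N\le\omega$, and an injective map $n\mapsto c_n\in T$ ($n<N$) with $|c_m|<|c_n|$ for $m<n$; write $l_n=|c_n|$. It codes the graph on vertices $\langle v_n:n<N\rangle$ in which, for $i<n$, $v_n$ and $v_i$ are adjacent iff $c_n(l_i)=1$. Two nodes $s,t$ have parallel $1$'s if $s(l)=t(l)=1$ for some $l<\min(|s|,|t|)$. A node $t$ splits in $T$ if there are $u,v\in T$ extending $t$ with $u(|t|)=0$, $v(|t|)=1$. The coding nodes are dense in $T$ if every $t\in T$ is extended by some coding node. A strong triangle-free tree is a tree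 with coding nodes $\langle c_n:n<N\rangle$ such that $l_n=n+1$ for all $n<N$ and: (1) if $N=\omega$, $T$ has no maximal nodes; if $N<\omega$, all maximal nodes have length $l_{N-1}$; (2) the stem of $T$ is the empty sequence; (3) $c_0=\langle 1\rangle$ and $c_n(l_{n-1})=1$ for $0<n<N$; (4) $0^{l_n}\in T$ for each $n<N$; (5) for each $n<N$ and each non-maximal $t\in T$ with $|t|=l_n$, $t$ splits in $T$ iff $t$ and $c_n$ have no parallel $1$'s. A coding node $c_n$ meets requirement $F$ (a finite subset of $\omega$) if: whenever there are no $j<k$ in $F$ with $c_k(l_j)=1$, then for all $k<n-1$, $c_n(l_k)=1$ iff $k\in F$. $T$ satisfies $(A_3)^{\mathrm{tree}}$ with respect to $\langle F_i\rangle$ if (i) (Triangle-Free Criterion) for each $t\in T$, $n$ with $l_n<|t|$, and $i<n$, if $t(l_i)=c_n(l_i)=1$ then $t(l_n)=0$; and (ii) for each $i<\omega$, if $c_k(l_j)=0$ for all $j<k$ in $F_i$, then there is $n\ge i$ such that for all $m<i$, $c_n(l_m)=1$ iff $m\in F_i$. $\mathcal{H}_3$ is the universal homogeneous triangle-free graph (Henson graph); $T$ codes $\mathcal{H}_3$ if the graph coded by its coding nodes is isomorphic to $\mathcal{H}_3$. *)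

theory Defs
  imports "HOL-Library.Sublist" "HOL-Library.Extended_Nat" "HOL-Library.Countable_Set"
begin

text \<open>
  Finite binary sequences are lists of Booleans, \<open>True\<close> standing for the digit \<open>1\<close>; the digit
  \<open>s(l)\<close> is \<open>s ! l\<close>, which is meaningful only for \<open>l < length s\<close>. Coding nodes are given
  by a total function \<open>c\<close>, of which only the values \<open>c n\<close> with \<open>n < N\<close> matter; \<open>l_n\<close> is
  \<open>length (c n)\<close>.
\<close>

type_synonym node = "bool list"

definition is_tree :: "node set \<Rightarrow> bool" where
  "is_tree T \<longleftrightarrow>
     (\<forall>s\<in>T. \<forall>t\<in>T. Longest_common_prefix {s, t} \<in> T) \<and>
     (\<forall>s\<in>T. \<forall>t\<in>T. length s \<le> length t \<longrightarrow> take (length s) t \<in> T)"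

definition comparable_with_all :: "node set \<Rightarrow> node \<Rightarrow> bool" where
  "comparable_with_all T s \<longleftrightarrow> (\<forall>t\<in>T. prefix s t \<or> prefix t s)"

definition is_stem :: "node set \<Rightarrow> node \<Rightarrow> bool" where
  "is_stem T s \<longleftrightarrow>
     s \<in> T \<and> comparable_with_all T s \<and>
     (\<forall>u\<in>T. comparable_with_all T u \<longrightarrow> length u \<le> length s)"

definition maximal_node :: "node set \<Rightarrow> node \<Rightarrow> bool" where
  "maximal_node T t \<longleftrightarrow> t \<in> T \<and> \<not> (\<exists>u\<in>T. strict_prefix t u)"

definition splits_in :: "node set \<Rightarrow> node \<Rightarrow> bool" where
  "splits_in T t \<longleftrightarrow>
     (\<exists>u\<in>T. \<exists>v\<in>T. strict_prefix t u \<and> strict_prefix t v \<and> \<not> u ! length t \<and> v ! length t)"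

definition parallel_ones :: "node \<Rightarrow> node \<Rightarrow> bool" where
  "parallel_ones s t \<longleftrightarrow> (\<exists>l < min (length s) (length t). s ! l \<and> t ! l)"

definition tree_with_coding_nodes :: "node set \<Rightarrow> enat \<Rightarrow> (nat \<Rightarrow> node) \<Rightarrow> bool" where
  "tree_with_coding_nodes T N c \<longleftrightarrow>
     is_tree T \<and>
     (\<forall>n. enat n < N \<longrightarrow> c n \<in> T) \<and>
     inj_on c {n. enat n < N} \<and>
     (\<forall>m n. m < n \<and> enat n < N \<longrightarrow> length (c m) < length (c n))"

definition coding_nodes_dense :: "node set \<Rightarrow> enat \<Rightarrow> (nat \<Rightarrow> node) \<Rightarrow> bool" where
  "coding_nodes_dense T N c \<longleftrightarrow> (\<forall>t\<in>T. \<exists>n. enat n < N \<and> prefix t (c n))"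

text \<open>
  The conjunct \<open>0 < N\<close> makes explicit that \<open>c_0\<close> is assumed to exist.
\<close>

definition strong_triangle_free_tree :: "node set \<Rightarrow> enat \<Rightarrow> (nat \<Rightarrow> node) \<Rightarrow> bool" where
  "strong_triangle_free_tree T N c \<longleftrightarrow>
     tree_with_coding_nodes T N c \<and> 0 < N \<and>
     (\<forall>n. enat n < N \<longrightarrow> length (c n) = n + 1) \<and>
     (N = \<infinity> \<longrightarrow> (\<forall>t. \<not> maximal_node T t)) \<and>
     (\<forall>k. N = enat (Suc k) \<longrightarrow> (\<forall>t. maximal_node T t \<longrightarrow> length t = length (c k))) \<and>
     is_stem T [] \<and>
     c 0 = [True] \<and>
     (\<forall>n. 0 < n \<and> enat n < N \<longrightarrow> c n ! length (c (n - 1))) \<and>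
     (\<forall>n. enat n < N \<longrightarrow> replicate (length (c n)) False \<in> T) \<and>
     (\<forall>n t. enat n < N \<and> t \<in> T \<and> \<not> maximal_node T t \<and> length t = length (c n) \<longrightarrow>
        (splits_in T t \<longleftrightarrow> \<not> parallel_ones t (c n)))"

definition meets_requirement :: "(nat \<Rightarrow> node) \<Rightarrow> nat \<Rightarrow> nat set \<Rightarrow> bool" where
  "meets_requirement c n F \<longleftrightarrow>
     (\<not> (\<exists>j\<in>F. \<exists>k\<in>F. j < k \<and> c k ! length (c j)) \<longrightarrow>
      (\<forall>k. k + 1 < n \<longrightarrow> (c n ! length (c k) \<longleftrightarrow> k \<in> F)))"

definition triangle_free_criterion :: "node set \<Rightarrow> (nat \<Rightarrow> node) \<Rightarrow> bool" where
  "triangle_free_criterion T c \<longleftrightarrow>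
     (\<forall>t\<in>T. \<forall>n i. length (c n) < length t \<and> i < n \<and> t ! length (c i) \<and> c n ! length (c i) \<longrightarrow>
        \<not> t ! length (c n))"

definition A3_tree :: "node set \<Rightarrow> (nat \<Rightarrow> node) \<Rightarrow> (nat \<Rightarrow> nat set) \<Rightarrow> bool" where
  "A3_tree T c F \<longleftrightarrow>
     triangle_free_criterion T c \<and>
     (\<forall>i. (\<forall>j\<in>F i. \<forall>k\<in>F i. j < k \<longrightarrow> \<not> c k ! length (c j)) \<longrightarrow>
        (\<exists>n\<ge>i. \<forall>m<i. c n ! length (c m) \<longleftrightarrow> m \<in> F i))"

text \<open>
  A graph is a vertex set \<open>V\<close> with an adjacency relation \<open>E\<close>, of which only the restriction to
  \<open>V\<close> matters; hence \<open>A\<close> with the same \<open>E\<close> is the induced subgraph on \<open>A \<subseteq> V\<close>.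
\<close>

definition simple_graph :: "'a set \<Rightarrow> ('a \<Rightarrow> 'a \<Rightarrow> bool) \<Rightarrow> bool" where
  "simple_graph V E \<longleftrightarrow> (\<forall>x\<in>V. \<not> E x x) \<and> (\<forall>x\<in>V. \<forall>y\<in>V. E x y \<longrightarrow> E y x)"

definition triangle_free :: "'a set \<Rightarrow> ('a \<Rightarrow> 'a \<Rightarrow> bool) \<Rightarrow> bool" where
  "triangle_free V E \<longleftrightarrow> \<not> (\<exists>x\<in>V. \<exists>y\<in>V. \<exists>z\<in>V. E x y \<and> E y z \<and> E x z)"

definition graph_iso ::
  "('a \<Rightarrow> 'b) \<Rightarrow> 'a set \<Rightarrow> ('a \<Rightarrow> 'a \<Rightarrow> bool) \<Rightarrow> 'b set \<Rightarrow> ('b \<Rightarrow> 'b \<Rightarrow> bool) \<Rightarrow> bool" where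
  "graph_iso f V E W R \<longleftrightarrow>
     bij_betw f V W \<and> (\<forall>x\<in>V. \<forall>y\<in>V. E x y \<longleftrightarrow> R (f x) (f y))"

definition homogeneous_graph :: "'a set \<Rightarrow> ('a \<Rightarrow> 'a \<Rightarrow> bool) \<Rightarrow> bool" where
  "homogeneous_graph V E \<longleftrightarrow>
     (\<forall>A B f. finite A \<and> A \<subseteq> V \<and> B \<subseteq> V \<and> graph_iso f A E B E \<longrightarrow>
        (\<exists>g. graph_iso g V E V E \<and> (\<forall>x\<in>A. g x = f x)))"

text \<open>
  Every countable graph is isomorphic to one whose vertices are natural numbers, so quantifying over
  \<open>W :: nat set\<close> covers all countable triangle-free graphs. Embeddings are onto induced subgraphs.
\<close>

definition universal_triangle_free :: "'a set \<Rightarrow> ('a \<Rightarrow> 'a \<Rightarrow> bool) \<Rightarrow> bool" where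
  "universal_triangle_free V E \<longleftrightarrow>
     (\<forall>(W :: nat set) R. simple_graph W R \<and> triangle_free W R \<longrightarrow>
        (\<exists>f. f ` W \<subseteq> V \<and> graph_iso f W R (f ` W) E))"

text \<open>
  These properties determine the Henson graph up to isomorphism.
\<close>

definition is_H3 :: "'a set \<Rightarrow> ('a \<Rightarrow> 'a \<Rightarrow> bool) \<Rightarrow> bool" where
  "is_H3 V E \<longleftrightarrow>
     countable V \<and> simple_graph V E \<and> triangle_free V E \<and>
     homogeneous_graph V E \<and> universal_triangle_free V E"

text \<open>The vertex \<open>v_n\<close> of the coded graph is represented by its index \<open>n\<close>.\<close>

definition coded_adj :: "(nat \<Rightarrow> node) \<Rightarrow> nat \<Rightarrow> nat \<Rightarrow> bool" where
  "coded_adj c m n \<longleftrightarrow>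
     (m < n \<and> c n ! length (c m)) \<or> (n < m \<and> c m ! length (c n))"

definition codes_H3 :: "enat \<Rightarrow> (nat \<Rightarrow> node) \<Rightarrow> bool" where
  "codes_H3 N c \<longleftrightarrow>
     (\<exists>(V :: nat set) E f. is_H3 V E \<and> graph_iso f {n. enat n < N} (coded_adj c) V E)"

end

theory Submission
  imports Defs
begin

text \<open>
  Digit \<open>0\<close> of every node is read as adjacency to an extra vertex preceding \<open>v_0\<close>, so that a node is
  the characteristic sequence of a finite vertex set. The tree \<open>S\<close> consists of all nodes whose vertex
  set is independent; it is determined by the coding nodes. For even \<open>n\<close> the vertex \<open>v_n\<close> is
  adjacent to its immediate predecessor only. Hence, for odd \<open>n\<close>, every node of \<open>S\<close> of length below
  \<open>n\<close>, padded with zeros and a final one, remains in \<open>S\<close> and may be chosen as \<open>c_n\<close>. The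
  indices \<open>4i+1\<close> serve the requirements, the indices \<open>4i+3\<close> the density of the coding nodes. Density
  yields the extension property of the coded graph, and this gives homogeneity by back and forth and
  universality by its forth half.
\<close>

section \<open>Graphs with the triangle-free extension property\<close>

text \<open>A relation is used instead of a function so that back steps become forth steps for the
  converse.\<close>

definition partial_iso :: "('a \<Rightarrow> 'a \<Rightarrow> bool) \<Rightarrow> ('b \<Rightarrow> 'b \<Rightarrow> bool) \<Rightarrow> ('a \<times> 'b) set \<Rightarrow> bool" where
  "partial_iso R E p \<longleftrightarrow>
     (\<forall>(a, b)\<in>p. \<forall>(a', b')\<in>p. (a = a' \<longleftrightarrow> b = b') \<and> (R a a' \<longleftrightarrow> E b b'))"

definition extension_property :: "('a \<Rightarrow> 'a \<Rightarrow> bool) \<Rightarrow> bool" where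
  "extension_property E \<longleftrightarrow>
     (\<forall>A B. finite B \<and> A \<subseteq> B \<and> (\<forall>a\<in>A. \<forall>a'\<in>A. \<not> E a a') \<longrightarrow>
        (\<exists>y. y \<notin> B \<and> (\<forall>b\<in>B. E y b \<longleftrightarrow> b \<in> A)))"

lemma partial_isoD:
  assumes "partial_iso R E p" "(a, b) \<in> p" "(a', b') \<in> p"
  shows "a = a' \<longleftrightarrow> b = b'" "R a a' \<longleftrightarrow> E b b'"
  using assms unfolding partial_iso_def by auto

lemma partial_iso_converse: "partial_iso R E p \<Longrightarrow> partial_iso E R (p\<inverse>)"
  unfolding partial_iso_def by auto

text \<open>An edge between the images of two neighbours of \<open>x\<close> would pull back to a
  triangle through \<open>x\<close> in \<open>W\<close>. These images are therefore independent, and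
  the extension property supplies a partner for \<open>x\<close>.\<close>

lemma partial_iso_forth:
  assumes ext: "extension_property E" and E: "simple_graph UNIV E"
    and R: "simple_graph W R" "triangle_free W R"
    and p: "partial_iso R E p" "finite p" "fst ` p \<subseteq> W" and x: "x \<in> W"
  obtains q where "partial_iso R E q" "finite q" "fst ` q \<subseteq> W" "p \<subseteq> q" "x \<in> fst ` q"
proof (cases "x \<in> fst ` p")
  case True
  with p show ?thesis using that by blast
next
  case False
  define A where "A = {b. \<exists>a. (a, b) \<in> p \<and> R x a}"
  have "A \<subseteq> snd ` p" by (force simp: A_def)
  moreover have "\<not> E b b'" if "b \<in> A" "b' \<in> A" for b b'
  proof
    assume "E b b'"
    obtain a a' where a: "(a, b) \<in> p" "R x a" "(a', b') \<in> p" "R x a'"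
      using \<open>b \<in> A\<close> \<open>b' \<in> A\<close> by (auto simp: A_def)
    have "R a a'" using partial_isoD(2)[OF p(1) a(1,3)] \<open>E b b'\<close> by simp
    moreover have "a \<in> W" "a' \<in> W" using a p(3) by force+
    ultimately show False using R(2) a x unfolding triangle_free_def by blast
  qed
  ultimately obtain y where y: "y \<notin> snd ` p" "\<And>b. b \<in> snd ` p \<Longrightarrow> E y b \<longleftrightarrow> b \<in> A"
    using ext p(2) unfolding extension_property_def by (meson finite_imageI)
  have new: "a \<noteq> x" "b \<noteq> y" "R x a \<longleftrightarrow> E y b" "R a x \<longleftrightarrow> E b y" if ab: "(a, b) \<in> p" for a b
  proof -
    show "a \<noteq> x" "b \<noteq> y" using False y(1) ab by force+
    have "b \<in> A \<longleftrightarrow> R x a"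
      unfolding A_def using ab partial_isoD(1)[OF p(1) ab] by blast
    moreover have "b \<in> snd ` p" using ab by force
    ultimately show 1: "R x a \<longleftrightarrow> E y b" using y(2) by simp
    have "a \<in> W" using ab p(3) by force
    then show "R a x \<longleftrightarrow> E b y" using 1 E R(1) x unfolding simple_graph_def by blast
  qed
  \<comment> \<open>The new pair is also compared with itself, so loops must be excluded on both
    sides.\<close>
  have "\<not> R x x" "\<not> E y y" using E R(1) x unfolding simple_graph_def by auto
  then have "partial_iso R E (insert (x, y) p)"
    unfolding partial_iso_def
    by (auto simp: new partial_isoD(1)[OF p(1)] partial_isoD(2)[OF p(1)] dest: new(1,2) partial_isoD(1)[OF p(1), THEN iffD1, OF _ _ refl])
  then show ?thesis using that[of "insert (x, y) p"] p x by auto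
qed

lemma partial_iso_Union_chain:
  assumes "\<And>n. partial_iso R E (P n)" "\<And>n. P n \<subseteq> P (Suc n)"
  shows "partial_iso R E (\<Union>n. P n)"
proof -
  have mono: "m \<le> n \<Longrightarrow> P m \<subseteq> P n" for m n
    using lift_Suc_mono_le[of P] assms(2) by blast
  have "(a = a' \<longleftrightarrow> b = b') \<and> (R a a' \<longleftrightarrow> E b b')" if "(a, b) \<in> P m" "(a', b') \<in> P n" for a b a' b' m n
  proof -
    have "(a, b) \<in> P (max m n)" "(a', b') \<in> P (max m n)"
      using that mono[of m "max m n"] mono[of n "max m n"] by auto
    then show ?thesis using partial_isoD[OF assms(1)] by blast
  qed
  then show ?thesis unfolding partial_iso_def by blast
qed

lemma graph_iso_of_partial_iso:
  assumes p: "partial_iso R E p"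
  obtains f where "graph_iso f (fst ` p) R (snd ` p) E" "\<And>a b. (a, b) \<in> p \<Longrightarrow> f a = b"
proof -
  have "\<forall>a\<in>fst ` p. \<exists>b. (a, b) \<in> p" by force
  then obtain f where f: "\<And>a. a \<in> fst ` p \<Longrightarrow> (a, f a) \<in> p" by metis
  have eq: "f a = b" if "(a, b) \<in> p" for a b
    using partial_isoD(1)[OF p that f] that by force
  have "inj_on f (fst ` p)"
    by (rule inj_onI) (metis f partial_isoD(1)[OF p])
  moreover have "f ` fst ` p = snd ` p"
    using eq by (force simp: image_image)
  moreover have "\<forall>a\<in>fst ` p. \<forall>a'\<in>fst ` p. R a a' \<longleftrightarrow> E (f a) (f a')"
    using f partial_isoD(2)[OF p] by blast
  ultimately have "graph_iso f (fst ` p) R (snd ` p) E"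
    by (simp add: graph_iso_def bij_betw_def)
  then show ?thesis using that eq by blast
qed

lemma universal_triangle_freeI:
  assumes "extension_property E" "simple_graph UNIV E"
  shows "universal_triangle_free UNIV E"
  unfolding universal_triangle_free_def
proof (intro allI impI)
  fix W :: "nat set" and R
  assume R: "simple_graph W R \<and> triangle_free W R"
  let ?I = "\<lambda>p. partial_iso R E p \<and> finite p \<and> fst ` p \<subseteq> W"
  \<comment> \<open>Stage \<open>n\<close> puts the number \<open>n\<close> into the domain if it is
    a vertex of \<open>W\<close>, and otherwise changes nothing.\<close>
  have "\<exists>P. \<forall>n. ?I (P n) \<and> (P n \<subseteq> P (Suc n) \<and> (n \<in> W \<longrightarrow> n \<in> fst ` P (Suc n)))"
  proof (rule dependent_nat_choice)
    show "\<exists>p. ?I p" by (rule exI[of _ "{}"]) (simp add: partial_iso_def)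
  next
    fix p :: "(nat \<times> 'a) set" and n assume p: "?I p"
    show "\<exists>q. ?I q \<and> (p \<subseteq> q \<and> (n \<in> W \<longrightarrow> n \<in> fst ` q))"
    proof (cases "n \<in> W")
      case True
      obtain q where "partial_iso R E q" "finite q" "fst ` q \<subseteq> W" "p \<subseteq> q" "n \<in> fst ` q"
        by (rule partial_iso_forth[OF assms, of W R p n]) (use R p True in auto)
      then show ?thesis by (intro exI[of _ q]) simp
    next
      case False
      then show ?thesis using p by (intro exI[of _ p]) simp
    qed
  qed
  then obtain P where P: "\<And>n. ?I (P n)" "\<And>n. P n \<subseteq> P (Suc n)" "\<And>n. n \<in> W \<Longrightarrow> n \<in> fst ` P (Suc n)"
    by metis
  have dom: "fst ` (\<Union>n. P n) = W" using P(1,3) by (fastforce simp: image_UN)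
  have "partial_iso R E (\<Union>n. P n)" by (rule partial_iso_Union_chain) (use P in auto)
  then obtain f where f: "graph_iso f (fst ` (\<Union>n. P n)) R (snd ` (\<Union>n. P n)) E"
    by (rule graph_iso_of_partial_iso)
  then have "f ` W = snd ` (\<Union>n. P n)" unfolding dom by (simp add: graph_iso_def bij_betw_def)
  with f show "\<exists>f. f ` W \<subseteq> UNIV \<and> graph_iso f W R (f ` W) E" unfolding dom by (metis subset_UNIV)
qed

lemma homogeneous_graphI:
  fixes E :: "nat \<Rightarrow> nat \<Rightarrow> bool"
  assumes E: "extension_property E" "simple_graph UNIV E" "triangle_free UNIV E"
  shows "homogeneous_graph UNIV E"
  unfolding homogeneous_graph_def
proof (intro allI impI)
  fix A B f
  assume "finite A \<and> A \<subseteq> UNIV \<and> B \<subseteq> UNIV \<and> graph_iso f A E B E"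
  then have A: "finite A" and f: "graph_iso f A E B E" by auto
  define p0 where "p0 = (\<lambda>a. (a, f a)) ` A"
  let ?I = "\<lambda>p. partial_iso E E p \<and> finite p"
  have p0: "?I p0"
    using A f by (auto simp: p0_def partial_iso_def graph_iso_def bij_betw_def inj_on_def)
  have forth: thesis if "?I p" "\<And>q. ?I q \<Longrightarrow> p \<subseteq> q \<Longrightarrow> n \<in> fst ` q \<Longrightarrow> thesis" for p n thesis
    by (rule partial_iso_forth[OF E(1,2) E(2,3), of p n]) (use that in auto)
  have "\<exists>P. \<forall>n. (?I (P n) \<and> p0 \<subseteq> P n) \<and>
      (P n \<subseteq> P (Suc n) \<and> n \<in> fst ` P (Suc n) \<and> n \<in> snd ` P (Suc n))"
  proof (rule dependent_nat_choice)
    show "\<exists>p. ?I p \<and> p0 \<subseteq> p" using p0 by (intro exI[of _ p0]) simp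
  next
    fix p n assume p: "?I p \<and> p0 \<subseteq> p"
    obtain q where q: "?I q" "p \<subseteq> q" "n \<in> fst ` q"
      by (rule forth[of p n]) (use p in auto)
    \<comment> \<open>Back step: a forth step for the converse puts \<open>n\<close> into the
      range.\<close>
    have "?I (q\<inverse>)" using q(1) partial_iso_converse by auto
    then obtain r where r: "?I r" "q\<inverse> \<subseteq> r" "n \<in> fst ` r"
      by (rule forth)
    have "?I (r\<inverse>)" using r(1) partial_iso_converse by auto
    moreover have "q \<subseteq> r\<inverse>" using r(2) by auto
    moreover have "n \<in> snd ` (r\<inverse>)" using r(3) by force
    moreover have "n \<in> fst ` (r\<inverse>)" using q(3) \<open>q \<subseteq> r\<inverse>\<close> by (meson image_mono subsetD)
    ultimately show "\<exists>r. (?I r \<and> p0 \<subseteq> r) \<and> (p \<subseteq> r \<and> n \<in> fst ` r \<and> n \<in> snd ` r)"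
      using p q(2) by (intro exI[of _ "r\<inverse>"]) auto
  qed
  then obtain P where P: "\<And>n. ?I (P n)" "\<And>n. p0 \<subseteq> P n" "\<And>n. P n \<subseteq> P (Suc n)"
    "\<And>n. n \<in> fst ` P (Suc n)" "\<And>n. n \<in> snd ` P (Suc n)"
    by metis
  have "partial_iso E E (\<Union>n. P n)" by (rule partial_iso_Union_chain) (use P in auto)
  then obtain g where g: "graph_iso g (fst ` (\<Union>n. P n)) E (snd ` (\<Union>n. P n)) E"
    "\<And>a b. (a, b) \<in> (\<Union>n. P n) \<Longrightarrow> g a = b"
    by (rule graph_iso_of_partial_iso) blast
  have "fst ` (\<Union>n. P n) = UNIV" "snd ` (\<Union>n. P n) = UNIV"
    using P(4,5) by (auto simp: image_UN)
  moreover have "g x = f x" if "x \<in> A" for x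
  proof (rule g(2))
    have "(x, f x) \<in> p0" using that by (simp add: p0_def)
    then show "(x, f x) \<in> (\<Union>n. P n)" using P(2) by blast
  qed
  ultimately show "\<exists>g. graph_iso g UNIV E UNIV E \<and> (\<forall>x\<in>A. g x = f x)"
    using g(1) by auto
qed

section \<open>The tree of independent nodes\<close>

text \<open>
  Digit \<open>k + 1\<close> of a node refers to \<open>c k\<close>; digit \<open>0\<close> refers to no coding node and is unconstrained.
\<close>

definition independent_node :: "(nat \<Rightarrow> node) \<Rightarrow> node \<Rightarrow> bool" where
  "independent_node c t \<longleftrightarrow>
     (\<forall>k. Suc k < length t \<and> t ! Suc k \<longrightarrow> \<not> parallel_ones (take (Suc k) t) (c k))"

text \<open>This is what allows coding nodes to be defined by recursion through independence with
  respect to earlier ones.\<close>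

lemma independent_node_cong:
  "(\<And>k. Suc k < length t \<Longrightarrow> c k = d k) \<Longrightarrow> independent_node c t \<longleftrightarrow> independent_node d t"
  by (auto simp: independent_node_def)

lemma independent_node_Nil [simp]: "independent_node c []"
  by (simp add: independent_node_def)

lemma independent_node_prefix:
  assumes "independent_node c t" "prefix s t"
  shows "independent_node c s"
  unfolding independent_node_def
proof (intro allI impI)
  fix k assume k: "Suc k < length s \<and> s ! Suc k"
  obtain w where "t = s @ w" using assms(2) by (auto simp: prefix_def)
  then show "\<not> parallel_ones (take (Suc k) s) (c k)"
    using k assms(1)[unfolded independent_node_def, rule_format, of k] by (simp add: nth_append)
qed

lemma independent_node_snoc:
  "independent_node c (t @ [b]) \<longleftrightarrow>
     independent_node c t \<and> (b \<longrightarrow> t = [] \<or> \<not> parallel_ones t (c (length t - 1)))"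
proof
  assume *: "independent_node c (t @ [b])"
  then have "independent_node c t" by (rule independent_node_prefix) simp
  moreover have "\<not> parallel_ones t (c (length t - 1))" if b "t \<noteq> []"
    using *[unfolded independent_node_def, rule_format, of "length t - 1"] that by simp
  ultimately show "independent_node c t \<and> (b \<longrightarrow> t = [] \<or> \<not> parallel_ones t (c (length t - 1)))"
    by blast
next
  assume *: "independent_node c t \<and> (b \<longrightarrow> t = [] \<or> \<not> parallel_ones t (c (length t - 1)))"
  show "independent_node c (t @ [b])"
    unfolding independent_node_def
  proof (intro allI impI)
    fix k assume k: "Suc k < length (t @ [b]) \<and> (t @ [b]) ! Suc k"
    show "\<not> parallel_ones (take (Suc k) (t @ [b])) (c k)"
    proof (cases "Suc k < length t")
      case True
      then show ?thesis using * k by (auto simp: independent_node_def nth_append)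
    next
      case False
      then have "length t = Suc k" using k by simp
      then show ?thesis using * k by (auto simp: nth_append)
    qed
  qed
qed

lemma independent_node_append_replicate:
  "independent_node c t \<Longrightarrow> independent_node c (t @ replicate m False)"
proof (induction m)
  case (Suc m)
  then show ?case
    using independent_node_snoc[of c "t @ replicate m False" False]
    by (simp add: replicate_append_same)
qed simp

text \<open>A parallel one below digit \<open>k + 1\<close> is not at digit \<open>0\<close>, which
  is \<open>False\<close>; it sits at some \<open>j + 1\<close> with \<open>j\<close> in
  \<open>A\<close> below \<open>k\<close>, against the hypothesis.\<close>

lemma independent_node_char:
  assumes A: "\<And>j k. j \<in> A \<Longrightarrow> k \<in> A \<Longrightarrow> j < k \<Longrightarrow> \<not> c k ! Suc j"
  shows "independent_node c (False # map (\<lambda>k. k \<in> A) [0..<m])" (is "independent_node c ?t")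
  unfolding independent_node_def
proof (intro allI impI notI)
  fix k
  assume k: "Suc k < length ?t \<and> ?t ! Suc k" and par: "parallel_ones (take (Suc k) ?t) (c k)"
  obtain l where l: "l < Suc k" "take (Suc k) ?t ! l" "c k ! l"
    using par unfolding parallel_ones_def by (metis length_take min_less_iff_conj)
  then have "?t ! l" by (simp only: nth_take)
  then obtain j where "l = Suc j" by (cases l) auto
  then show False using l(1,3) \<open>?t ! l\<close> k A[of j k] by auto
qed

section \<open>Trees with dense coding nodes\<close>

text \<open>These properties yield everything claimed except the requirements met at prescribed
  indices. For positive \<open>n\<close>, \<open>c_last\<close> is adjacency of consecutive
  vertices; for \<open>n = 0\<close> it forces \<open>c 0 = [True]\<close>.\<close>

locale dense_coding =
  fixes c :: "nat \<Rightarrow> node"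
  assumes length_c [simp]: "length (c n) = Suc n"
    and c_independent: "independent_node c (c n)"
    and c_last: "c n ! n"
    and dense: "independent_node c t \<Longrightarrow> \<exists>n. prefix t (c n)"
begin

abbreviation S :: "node set" where "S \<equiv> {t. independent_node c t}"

lemma triangle_free_criterion: "triangle_free_criterion S c"
  unfolding triangle_free_criterion_def
proof (intro ballI allI impI)
  fix t n i
  assume t: "t \<in> S"
    and *: "length (c n) < length t \<and> i < n \<and> t ! length (c i) \<and> c n ! length (c i)"
  have "parallel_ones (take (Suc n) t) (c n)"
    unfolding parallel_ones_def using * by (intro exI[of _ "Suc i"]) simp
  then show "\<not> t ! length (c n)" using t * by (auto simp: independent_node_def)
qed

lemma no_maximal_node: "\<not> maximal_node S t"
proof
  assume "maximal_node S t"
  moreover have "strict_prefix t (t @ [False])" by (simp add: strict_prefix_def)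
  ultimately show False
    unfolding maximal_node_def using independent_node_snoc[of c t False] by blast
qed

text \<open>Appending \<open>False\<close> never leaves \<open>S\<close>, so splitting depends only
  on whether \<open>True\<close> may be appended.\<close>

lemma splits_in_iff:
  assumes "t \<in> S" "length t = Suc n"
  shows "splits_in S t \<longleftrightarrow> \<not> parallel_ones t (c n)"
proof
  assume "splits_in S t"
  then obtain v where v: "independent_node c v" "strict_prefix t v" "v ! length t"
    by (auto simp: splits_in_def)
  then obtain x w where "v = t @ x # w" by (auto elim: strict_prefixE')
  then have "x" "independent_node c (t @ [x])"
    using v(3) independent_node_prefix[OF v(1), of "t @ [x]"] by simp_all
  then show "\<not> parallel_ones t (c n)"
    using assms(2) by (auto simp: independent_node_snoc)
next
  assume "\<not> parallel_ones t (c n)"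
  then have "t @ [False] \<in> S" "t @ [True] \<in> S" using assms by (auto simp: independent_node_snoc)
  moreover have "strict_prefix t (t @ [b])" for b by (simp add: strict_prefix_def)
  ultimately show "splits_in S t"
    unfolding splits_in_def by (metis nth_append_length)
qed

lemma is_tree_S: "is_tree S"
  unfolding is_tree_def
proof (intro conjI ballI impI)
  fix s t assume "s \<in> S" "t \<in> S"
  moreover have "prefix (Longest_common_prefix {s, t}) s"
    by (rule Longest_common_prefix_prefix) simp
  ultimately show "Longest_common_prefix {s, t} \<in> S" using independent_node_prefix by auto
next
  fix s t assume "t \<in> S"
  then show "take (length s) t \<in> S" using independent_node_prefix[OF _ take_is_prefix] by simp
qed

text \<open>Digit \<open>0\<close> is unconstrained, so both one-element sequences lie in
  \<open>S\<close>.\<close>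

lemma is_stem_Nil: "is_stem S []"
proof -
  have "u = []" if "comparable_with_all S u" for u
  proof -
    have "[b] \<in> S" for b using independent_node_snoc[of c "[]"] by simp
    then have "prefix u [b] \<or> prefix [b] u" for b
      using that unfolding comparable_with_all_def by blast
    from this[of True] this[of False] show "u = []" by (cases u) auto
  qed
  then show ?thesis unfolding is_stem_def by (auto simp: comparable_with_all_def)
qed

lemma strong_triangle_free_tree: "strong_triangle_free_tree S \<infinity> c"
proof -
  have "inj c" by (rule injI) (metis Suc_inject length_c)
  moreover have "c 0 = [True]" using c_last[of 0] length_c[of 0] by (cases "c 0") auto
  moreover have "independent_node c (replicate m False)" for m
    using independent_node_append_replicate[of c "[]"] by simp
  ultimately show ?thesis
    unfolding strong_triangle_free_tree_def tree_with_coding_nodes_def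
    using is_tree_S is_stem_Nil no_maximal_node splits_in_iff c_independent c_last
    by (simp add: inj_on_def del: replicate_Suc)
qed

text \<open>The characteristic node of \<open>A\<close> below \<open>m\<close>, preceded by digit
  \<open>0\<close>, is independent; a coding node extending it exists by density, and its length
  forces \<open>m \<le> n\<close>.\<close>

lemma realize:
  assumes "\<And>j k. j \<in> A \<Longrightarrow> k \<in> A \<Longrightarrow> j < k \<Longrightarrow> \<not> c k ! Suc j"
  obtains n where "m \<le> n" "\<And>k. k < m \<Longrightarrow> c n ! Suc k \<longleftrightarrow> k \<in> A"
proof -
  let ?t = "False # map (\<lambda>k. k \<in> A) [0..<m]"
  have "independent_node c ?t"
    using assms by (intro independent_node_char) auto
  then obtain n where "prefix ?t (c n)" using dense by blast
  then obtain w where w: "c n = ?t @ w" by (auto simp: prefix_def)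
  have "m \<le> n" using arg_cong[OF w, of length] by simp
  moreover have "c n ! Suc k \<longleftrightarrow> k \<in> A" if "k < m" for k
    using that by (simp add: w nth_append)
  ultimately show ?thesis using that by blast
qed

lemma A3_tree: "A3_tree S c F"
  unfolding A3_tree_def
proof (intro conjI allI impI)
  fix i assume "\<forall>j\<in>F i. \<forall>k\<in>F i. j < k \<longrightarrow> \<not> c k ! length (c j)"
  then obtain n where "i \<le> n" "\<And>k. k < i \<Longrightarrow> c n ! Suc k \<longleftrightarrow> k \<in> F i"
    using realize[of "F i" i] by auto
  then show "\<exists>n\<ge>i. \<forall>m<i. c n ! length (c m) \<longleftrightarrow> m \<in> F i" by auto
qed (rule triangle_free_criterion)

section \<open>The coded graph is the Henson graph\<close>

lemma simple_graph_coded: "simple_graph UNIV (coded_adj c)"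
  by (auto simp: simple_graph_def coded_adj_def)

text \<open>The coding node of the largest vertex lies in \<open>S\<close>, so the triangle-free
  criterion applies to it; the six instances cover all orders of the three vertices.\<close>

lemma triangle_free_coded: "triangle_free UNIV (coded_adj c)"
proof -
  have *: "\<not> (c y ! Suc x \<and> c z ! Suc x \<and> c z ! Suc y)" if "x < y" "y < z" for x y z
    using triangle_free_criterion[unfolded triangle_free_criterion_def, rule_format, of "c z" y x]
      c_independent[of z] that by auto
  have False if "coded_adj c x y" "coded_adj c y z" "coded_adj c x z" for x y z
    using that *[of x y z] *[of x z y] *[of y x z] *[of y z x] *[of z x y] *[of z y x]
    by (auto simp: coded_adj_def)
  then show ?thesis unfolding triangle_free_def by blast
qed

text \<open>The new vertex is chosen beyond a bound of \<open>B\<close>, so its adjacencies to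
  \<open>B\<close> are digits of its own coding node.\<close>

lemma extension_property_coded: "extension_property (coded_adj c)"
  unfolding extension_property_def
proof (intro allI impI)
  fix A B :: "nat set"
  assume *: "finite B \<and> A \<subseteq> B \<and> (\<forall>a\<in>A. \<forall>a'\<in>A. \<not> coded_adj c a a')"
  then have "finite B" by simp
  then obtain m where m: "B \<subseteq> {..<m}" unfolding finite_nat_iff_bounded by (elim exE)
  have "\<not> c k ! Suc j" if "j \<in> A" "k \<in> A" "j < k" for j k
    using * that by (auto simp: coded_adj_def)
  then obtain n where n: "m \<le> n" "\<And>k. k < m \<Longrightarrow> c n ! Suc k \<longleftrightarrow> k \<in> A"
    using realize[of A m] by auto
  have "coded_adj c n b \<longleftrightarrow> b \<in> A" if "b \<in> B" for b
  proof -
    have "b < m" using m that by auto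
    then show ?thesis using n by (auto simp: coded_adj_def)
  qed
  moreover have "n \<notin> B" using m n(1) by auto
  ultimately show "\<exists>y. y \<notin> B \<and> (\<forall>b\<in>B. coded_adj c y b \<longleftrightarrow> b \<in> A)" by auto
qed

lemma codes_H3: "codes_H3 \<infinity> c"
proof -
  have "is_H3 UNIV (coded_adj c)"
    unfolding is_H3_def
    using simple_graph_coded triangle_free_coded extension_property_coded
      homogeneous_graphI universal_triangle_freeI by auto
  moreover have "graph_iso id {n. enat n < \<infinity>} (coded_adj c) UNIV (coded_adj c)"
    by (simp add: graph_iso_def)
  ultimately show ?thesis unfolding codes_H3_def by blast
qed

end

section \<open>Construction of the coding nodes\<close>

text \<open>
  Through the first component of \<open>prod_decode\<close> every node is proposed at infinitely many indices
  \<open>4i+3\<close>, hence also at one exceeding its length.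
\<close>

definition proposal :: "(nat \<Rightarrow> nat set) \<Rightarrow> nat \<Rightarrow> node" where
  "proposal F n =
     (if n mod 4 = 1 then False # map (\<lambda>k. k \<in> F (3 * (n div 4) + 1)) [0..<n - 2]
      else if n mod 4 = 3 then from_nat (fst (prod_decode (n div 4)))
      else [])"

text \<open>For positive \<open>n\<close> the strict length bound reserves digit
  \<open>n - 1\<close> for a padding zero. The fallback \<open>[]\<close> is always
  independent.\<close>

definition base :: "(nat \<Rightarrow> nat set) \<Rightarrow> nat \<Rightarrow> (nat \<Rightarrow> node) \<Rightarrow> node" where
  "base F n c =
     (if length (proposal F n) < n \<and> independent_node c (proposal F n) then proposal F n else [])"

definition pad :: "nat \<Rightarrow> node \<Rightarrow> node" where
  "pad n t = t @ replicate (n - length t) False @ [True]"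

text \<open>Earlier values enter as a finite table, which keeps the recursive calls below
  \<open>n\<close>; entries from \<open>n\<close> on are unspecified.\<close>

fun coding :: "(nat \<Rightarrow> nat set) \<Rightarrow> nat \<Rightarrow> node" where
  "coding F n = pad n (base F n ((!) (map (coding F) [0..<n])))"

declare coding.simps [simp del]

text \<open>A proposal shorter than \<open>n\<close> consults only entries inside the table, so the
  table may be replaced by the function.\<close>

lemma coding_eq: "coding F n = pad n (base F n (coding F))"
proof -
  have "length (proposal F n) < n \<Longrightarrow>
      independent_node ((!) (map (coding F) [0..<n])) (proposal F n) \<longleftrightarrow>
      independent_node (coding F) (proposal F n)"
    by (rule independent_node_cong) simp
  then show ?thesis unfolding coding.simps[of F n] base_def by auto
qed

lemma base_le: "length (base F n c) \<le> n"
  by (simp add: base_def)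

lemma base_less: "0 < n \<Longrightarrow> length (base F n c) < n"
  by (simp add: base_def)

lemma base_independent: "independent_node c (base F n c)"
  by (simp add: base_def)

lemma base_even: "even n \<Longrightarrow> base F n c = []"
proof -
  assume "even n"
  then have "n mod 4 \<noteq> 1" "n mod 4 \<noteq> 3" by presburger+
  then show ?thesis by (simp add: base_def proposal_def)
qed

lemma length_coding [simp]: "length (coding F n) = Suc n"
  using base_le[of F n "coding F"] by (simp add: coding_eq pad_def)

lemma coding_even: "even n \<Longrightarrow> coding F n = replicate n False @ [True]"
  by (simp add: coding_eq base_even pad_def)

text \<open>Only the final one needs care. For even \<open>n\<close> all digits before it are zero;
  for odd \<open>n\<close> the preceding coding node has its single one at digit
  \<open>n - 1\<close>, where the padded base has a zero.\<close>

lemma coding_independent: "independent_node (coding F) (coding F n)"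
proof -
  let ?c = "coding F"
  let ?t = "base F n ?c"
  let ?s = "?t @ replicate (n - length ?t) False"
  have s: "independent_node ?c ?s" "length ?s = n"
    using base_independent independent_node_append_replicate base_le[of F n ?c] by auto
  have "\<not> parallel_ones ?s (?c (n - 1))" if "n \<noteq> 0"
  proof (cases "even n")
    case True
    then show ?thesis by (auto simp: base_even parallel_ones_def)
  next
    case False
    then have "?c (n - 1) = replicate (n - 1) False @ [True]" by (intro coding_even) auto
    then have "l = n - 1" if "?c (n - 1) ! l" "l < n" for l
      using that by (auto simp: nth_append split: if_splits)
    moreover have "\<not> ?s ! (n - 1)"
      using base_less[of n F ?c] that by (auto simp: nth_append)
    ultimately show ?thesis
      unfolding parallel_ones_def s(2) by (metis min_less_iff_conj)
  qed
  then have "independent_node ?c (?s @ [True])"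
    unfolding independent_node_snoc using s by auto
  then show ?thesis by (simp add: coding_eq[of F n] pad_def)
qed

lemma coding_last: "coding F n ! n"
  using base_le[of F n "coding F"] by (simp add: coding_eq pad_def nth_append)

lemma coding_dense:
  assumes "independent_node (coding F) t"
  shows "\<exists>n. prefix t (coding F n)"
proof -
  \<comment> \<open>The second component makes \<open>i\<close> at least the length of
    \<open>t\<close>, so \<open>t\<close> is shorter than \<open>4 * i + 3\<close> and is
    accepted.\<close>
  define i where "i = prod_encode (to_nat t, length t)"
  define n where "n = 4 * i + 3"
  have "length t \<le> i" unfolding i_def by (rule le_prod_encode_2)
  moreover have "n mod 4 = 3" "n div 4 = i" by (auto simp: n_def)
  then have "proposal F n = t" by (simp add: proposal_def i_def)
  ultimately have "base F n (coding F) = t" using assms by (simp add: base_def n_def)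
  then have "prefix t (coding F n)" by (simp add: coding_eq[of F n] pad_def)
  then show ?thesis by blast
qed

interpretation coding: dense_coding "coding F" for F
  by unfold_locales (use coding_independent coding_last coding_dense in auto)

text \<open>The single one of the coding node is at digit \<open>n\<close>, which refers to the
  index \<open>n - 1\<close> outside the required range.\<close>

lemma coding_meets_empty: "even n \<Longrightarrow> meets_requirement (coding F) n {}"
  by (simp add: meets_requirement_def coding_even nth_append)

lemma coding_meets_requirement:
  assumes "F (3 * i + 1) \<subseteq> {k. k + 2 \<le> 3 * i + 1}"
  shows "meets_requirement (coding F) (4 * i + 1) (F (3 * i + 1))"
\<comment> \<open>For \<open>i = 0\<close> no \<open>k\<close> is in range. Otherwise
  \<open>?t\<close> has length \<open>4 * i\<close>, just below \<open>?n\<close>; truncated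
  subtraction would break this bound at \<open>i = 0\<close>.\<close>
proof (cases "i = 0")
  case True
  then show ?thesis by (simp add: meets_requirement_def)
next
  case False
  let ?A = "F (3 * i + 1)"
  let ?n = "4 * i + 1"
  let ?t = "False # map (\<lambda>k. k \<in> ?A) [0..<?n - 2]"
  have proposal: "proposal F ?n = ?t"
  proof -
    have "?n mod 4 = 1" "?n div 4 = i" by presburger+
    then show ?thesis unfolding proposal_def by simp
  qed
  show ?thesis
    unfolding meets_requirement_def
  proof (intro impI allI)
    fix k assume indep: "\<not> (\<exists>j\<in>?A. \<exists>k\<in>?A. j < k \<and> coding F k ! length (coding F j))"
      and k: "k + 1 < ?n"
    have "independent_node (coding F) ?t"
      by (rule independent_node_char) (use indep in auto)
    then have "base F ?n (coding F) = ?t"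
      using False unfolding base_def proposal by simp
    then have c: "coding F ?n = pad ?n ?t" by (simp only: coding_eq[of F ?n])
    show "coding F ?n ! length (coding F k) \<longleftrightarrow> k \<in> ?A"
    proof (cases "k < ?n - 2")
      case True
      then show ?thesis unfolding c pad_def by (simp add: nth_append)
    next
      case False
      \<comment> \<open>Here \<open>k = 4i - 1\<close>, the only neighbour of the predecessor of \<open>v_n\<close>; it exceeds all of \<open>F_{3i+1}\<close>.\<close>
      then have "k = ?n - 2" using k by simp
      moreover have "?n - 2 \<notin> ?A" using assms \<open>i \<noteq> 0\<close> by auto
      ultimately show ?thesis using \<open>i \<noteq> 0\<close> unfolding c pad_def by (simp add: nth_append)
    qed
  qed
qed

theorem theorem3p14:
  fixes F :: "nat \<Rightarrow> nat set"
  assumes "\<And>i. finite (F i)"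
    and "\<And>A. finite A \<Longrightarrow> infinite {i. F i = A}"
    and "\<And>i. F i \<subseteq> {k. k + 2 \<le> i}"
    and "\<And>i. F (3 * i) = {}"
    and "\<And>i. F (3 * i + 2) = {}"
  shows "\<exists>S c. strong_triangle_free_tree S \<infinity> c \<and>
           coding_nodes_dense S \<infinity> c \<and>
           A3_tree S c F \<and>
           codes_H3 \<infinity> c \<and>
           (\<forall>i j. j \<le> 2 \<longrightarrow> meets_requirement c (4 * i + j) (F (3 * i + j)))"
proof -
  have "meets_requirement (coding F) (4 * i + j) (F (3 * i + j))" if "j \<le> 2" for i j
  proof -
    have "j = 0 \<or> j = 1 \<or> j = 2" using that by arith
    then show ?thesis
      using coding_meets_empty[of "4 * i" F] coding_meets_empty[of "4 * i + 2" F]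
        coding_meets_requirement[of F i] assms(3)[of "3 * i + 1"] assms(4)[of i] assms(5)[of i]
      by (elim disjE) simp_all
  qed
  moreover have "coding_nodes_dense {t. independent_node (coding F) t} \<infinity> (coding F)"
    using coding.dense by (simp add: coding_nodes_dense_def)
  ultimately show ?thesis
    using coding.strong_triangle_free_tree coding.A3_tree coding.codes_H3 by blast
qed

end
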